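(* Let $\mathcal{C}$ be an extension-closed pseudovariety of finite groups. Let $G$ be a finitely generated pro-$\mathcal{C}$ group and $H$ a closed finitely generated subgroup of $G$. Then $H$ is a free pro-$\mathcal{C}$ factor of $G$ if and only if for every group $P$ from $\mathcal{C}$, the number $h(G,H,\gamma,P)$ is independent of the choice of $\gamma\in\mathrm{Hom}(H,P)$.
   Context: A pseudovariety of finite groups is a nonempty class of finite groups closed under taking subgroups, homomorphic images and finite direct products; it is extension-closed if moreover any finite group that is an extension of a group in the class by a group in the class lies in the class. A pro-$\mathcal{C}$ group is an inverse limit of groups in $\mathcal{C}$. Generation of profinite groups is topological, and homomorphisms between profinite groups (in particular elements of $\mathrm{Hom}(H,P)$ with $P$ finite discrete) are continuous. For a closed subgroup $H\le G$, $P\in\mathcal{C}$ and a homomorphism $\gamma:H\to P$, $h(G,H,\gamma,P)$ is the number of (continuous) homomorphisms $\tilde\gamma:G\to P$ with $\tilde\gamma|_H=\gamma$. For closed subgroups $\Delta_1,\Delta_2$ of a pro-$\mathcal{C}$ group $G$, one writes $G=\Delta_1\coprod_{\mathcal{C}}\Delta_2$ (free pro-$\mathcal{C}$ product) if for every $P\in\mathcal{C}$ and every pair of continuous homomorphisms $\psi_i:\Delta_i\to P$ ($i=1,2$) there is a unique continuous homomorphism $\psi:G\to P$ with $\psi|_{\Delta_i}=\psi_i$, $i=1,2$. A closed subgroup $H$ of $G$ is a free pro-$\mathcal{C}$ factor of $G$ if there is a closed subgroup $K\le G$ with $G=H\coprod_{\mathcal{C}}K$. *)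

theory Defs
  imports "HOL-Analysis.Analysis" "HOL-Algebra.Product_Groups" "HOL-Algebra.Generated_Groups"
begin

(* A class of finite groups is represented by the set of its members whose elements are
   natural numbers.  Every finite group is isomorphic to such a group, and closure under
   homomorphic images includes closure under isomorphism, so nothing is lost. *)

locale pseudovariety =
  fixes C :: "nat monoid set"
  assumes nonempty: "C \<noteq> {}"
    and is_group: "P \<in> C \<Longrightarrow> group P"
    and is_finite: "P \<in> C \<Longrightarrow> finite (carrier P)"
    and subgroup_closed: "P \<in> C \<Longrightarrow> subgroup H P \<Longrightarrow> P\<lparr>carrier := H\<rparr> \<in> C"
    and image_closed: "P \<in> C \<Longrightarrow> group Q \<Longrightarrow> f \<in> epi P Q \<Longrightarrow> Q \<in> C"
    and product_closed: "P \<in> C \<Longrightarrow> Q \<in> C \<Longrightarrow> group R \<Longrightarrow> R \<cong> P \<times>\<times> Q \<Longrightarrow> R \<in> C"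

locale extension_closed_pseudovariety = pseudovariety +
  assumes extension_closed:
    "group E \<Longrightarrow> finite (carrier E) \<Longrightarrow> normal N E \<Longrightarrow> E\<lparr>carrier := N\<rparr> \<in> C \<Longrightarrow>
     Q \<in> C \<Longrightarrow> E Mod N \<cong> Q \<Longrightarrow> E \<in> C"

locale topological_group = group G for G (structure) +
  fixes T :: "'a topology"
  assumes topspace_eq: "topspace T = carrier G"
    and continuous_mult: "continuous_map (prod_topology T T) T (\<lambda>(x, y). x \<otimes> y)"
    and continuous_inv: "continuous_map T T (\<lambda>x. inv x)"

(* A pair (i, j) in r means that i is below j, and phi i j maps A j to A i. *)
definition inverse_system ::
  "'i set \<Rightarrow> ('i \<times> 'i) set \<Rightarrow> ('i \<Rightarrow> 'b monoid) \<Rightarrow> ('i \<Rightarrow> 'i \<Rightarrow> 'b \<Rightarrow> 'b) \<Rightarrow> bool"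
  where "inverse_system I r A \<phi> \<longleftrightarrow>
    I \<noteq> {} \<and> partial_order_on I r \<and>
    (\<forall>i\<in>I. \<forall>j\<in>I. \<exists>k\<in>I. (i, k) \<in> r \<and> (j, k) \<in> r) \<and>
    (\<forall>i\<in>I. group (A i)) \<and>
    (\<forall>i j. (i, j) \<in> r \<longrightarrow> \<phi> i j \<in> hom (A j) (A i)) \<and>
    (\<forall>i\<in>I. \<forall>x\<in>carrier (A i). \<phi> i i x = x) \<and>
    (\<forall>i j k. (i, j) \<in> r \<longrightarrow> (j, k) \<in> r \<longrightarrow>
       (\<forall>x\<in>carrier (A k). \<phi> i j (\<phi> j k x) = \<phi> i k x))"

definition inverse_limit ::
  "'i set \<Rightarrow> ('i \<times> 'i) set \<Rightarrow> ('i \<Rightarrow> 'b monoid) \<Rightarrow> ('i \<Rightarrow> 'i \<Rightarrow> 'b \<Rightarrow> 'b) \<Rightarrow> ('i \<Rightarrow> 'b) monoid"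
  where "inverse_limit I r A \<phi> =
    (product_group I A)\<lparr>carrier :=
       {x \<in> carrier (product_group I A). \<forall>i j. (i, j) \<in> r \<longrightarrow> \<phi> i j (x j) = x i}\<rparr>"

definition inverse_limit_topology ::
  "'i set \<Rightarrow> ('i \<times> 'i) set \<Rightarrow> ('i \<Rightarrow> 'b monoid) \<Rightarrow> ('i \<Rightarrow> 'i \<Rightarrow> 'b \<Rightarrow> 'b) \<Rightarrow> ('i \<Rightarrow> 'b) topology"
  where "inverse_limit_topology I r A \<phi> =
    subtopology (product_topology (\<lambda>i. discrete_topology (carrier (A i))) I)
      (carrier (inverse_limit I r A \<phi>))"

(* Indices are taken from the type of subsets of G.  This is no restriction: if C is a
   pseudovariety, an inverse limit G of groups in C over any index type is also the inverse
   limit of its quotients G/U lying in C, indexed by the open normal subgroups U of G. *)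
definition pro_C_group :: "nat monoid set \<Rightarrow> 'a monoid \<Rightarrow> 'a topology \<Rightarrow> bool"
  where "pro_C_group C G T \<longleftrightarrow>
    topological_group G T \<and>
    (\<exists>(I :: 'a set set) r A \<phi> f.
       inverse_system I r A \<phi> \<and> (\<forall>i\<in>I. A i \<in> C) \<and>
       f \<in> iso G (inverse_limit I r A \<phi>) \<and>
       homeomorphic_map T (inverse_limit_topology I r A \<phi>) f)"

definition closed_subgroup :: "'a monoid \<Rightarrow> 'a topology \<Rightarrow> 'a set \<Rightarrow> bool"
  where "closed_subgroup G T H \<longleftrightarrow> subgroup H G \<and> closedin T H"

definition top_finitely_generated :: "'a monoid \<Rightarrow> 'a topology \<Rightarrow> bool"
  where "top_finitely_generated G T \<longleftrightarrow>
    (\<exists>S. finite S \<and> S \<subseteq> carrier G \<and> T closure_of (generate G S) = carrier G)"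

(* Continuous homomorphisms to the discrete group P.  They are made extensional so that
   counting and uniqueness refer to maps on the carrier of G. *)
definition cont_hom :: "'a monoid \<Rightarrow> 'a topology \<Rightarrow> 'b monoid \<Rightarrow> ('a \<Rightarrow> 'b) set"
  where "cont_hom G T P =
    {f \<in> hom G P. f \<in> extensional (carrier G) \<and>
       continuous_map T (discrete_topology (carrier P)) f}"

abbreviation cont_hom_on ::
  "'a monoid \<Rightarrow> 'a topology \<Rightarrow> 'a set \<Rightarrow> 'b monoid \<Rightarrow> ('a \<Rightarrow> 'b) set"
  where "cont_hom_on G T H P \<equiv> cont_hom (G\<lparr>carrier := H\<rparr>) (subtopology T H) P"

(* For topologically finitely generated G and finite P the set counted here is finite. *)
definition num_extensions ::
  "'a monoid \<Rightarrow> 'a topology \<Rightarrow> 'a set \<Rightarrow> ('a \<Rightarrow> 'b) \<Rightarrow> 'b monoid \<Rightarrow> nat"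
  where "num_extensions G T H \<gamma> P = card {f \<in> cont_hom G T P. \<forall>x\<in>H. f x = \<gamma> x}"

definition is_free_pro_C_product ::
  "nat monoid set \<Rightarrow> 'a monoid \<Rightarrow> 'a topology \<Rightarrow> 'a set \<Rightarrow> 'a set \<Rightarrow> bool"
  where "is_free_pro_C_product C G T D1 D2 \<longleftrightarrow>
    closed_subgroup G T D1 \<and> closed_subgroup G T D2 \<and>
    (\<forall>P\<in>C. \<forall>\<psi>1\<in>cont_hom_on G T D1 P. \<forall>\<psi>2\<in>cont_hom_on G T D2 P.
       \<exists>!\<psi>. \<psi> \<in> cont_hom G T P \<and> (\<forall>x\<in>D1. \<psi> x = \<psi>1 x) \<and> (\<forall>x\<in>D2. \<psi> x = \<psi>2 x))"

definition free_pro_C_factor ::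
  "nat monoid set \<Rightarrow> 'a monoid \<Rightarrow> 'a topology \<Rightarrow> 'a set \<Rightarrow> bool"
  where "free_pro_C_factor C G T H \<longleftrightarrow>
    (\<exists>K. closed_subgroup G T K \<and> is_free_pro_C_product C G T H K)"

end

theory Submission
  imports Defs
begin

text \<open>
  If \<open>G\<close> is the free pro-\<open>C\<close> product of \<open>H\<close> and \<open>K\<close>, restriction to \<open>K\<close> is a bijection from
  the extensions of any \<open>\<gamma> : H \<rightarrow> P\<close> onto \<open>Hom(K, P)\<close>, so their number does not depend on \<open>\<gamma>\<close>
  (\<open>num_extensions_free_product\<close>).

  Conversely, let the numbers of extensions be independent of \<open>\<gamma>\<close>. A free complement of \<open>H\<close> must
  be a copy of the quotient of \<open>G\<close> by the normal closure of \<open>H\<close>; it is found as the image of a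
  continuous endomorphism \<open>s\<close> of \<open>G\<close> that kills \<open>H\<close> and whose image generates \<open>G\<close>
  topologically together with \<open>H\<close>.

  Such an \<open>s\<close> is built one finite quotient at a time. Let \<open>p : G \<rightarrow> P\<close> with \<open>P\<close> in \<open>C\<close>. For
  every subgroup \<open>R\<close> of \<open>P\<close> containing \<open>p(H)\<close>, the hypothesis for the group \<open>R\<close> says that as many
  homomorphisms \<open>G \<rightarrow> R\<close> are trivial on \<open>H\<close> as agree with \<open>p\<close> on \<open>H\<close>. Moebius inversion over
  these subgroups refines this to an equality between the numbers of such homomorphisms \<open>q\<close>
  for which \<open>p(H)\<close> and \<open>q(G)\<close> together generate exactly \<open>R\<close>. For \<open>R = p(G)\<close> the second number
  is positive, since it counts \<open>p\<close> itself; hence some \<open>q\<close> is trivial on \<open>H\<close> and satisfies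
  \<open>\<langle>p(H), q(G)\<rangle> = p(G)\<close> (\<open>exists_hom_generating_with_subgroup\<close>). Because \<open>G\<close> is finitely
  generated, the set of these \<open>q\<close> is finite; these sets form an inverse system along the
  finite coordinates of \<open>G\<close>, and a point of its limit is the required \<open>s\<close>
  (\<open>exists_endomorphism_generating_with_subgroup\<close>).

  Finally, let \<open>K = s(G)\<close> and \<open>\<psi>\<^sub>1 : H \<rightarrow> P\<close>. Restriction to \<open>K\<close> embeds the extensions of \<open>\<psi>\<^sub>1\<close>
  into \<open>Hom(K, P)\<close>, because \<open>H\<close> and \<open>K\<close> generate \<open>G\<close>. Composition with \<open>s\<close> embeds
  \<open>Hom(K, P)\<close> into the extensions of the trivial homomorphism, of which there are as many as
  extensions of \<open>\<psi>\<^sub>1\<close>. All these sets are finite, so the first embedding is a bijection, which is the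
  universal property of the free product (\<open>free_product_with_image\<close>).
\<close>


section \<open>Inverse limits of finite sets\<close>

lemma directed_finite_upper_bound:
  assumes "I \<noteq> {}" "trans r" "finite J" "J \<subseteq> I"
    and "\<And>i j. i \<in> I \<Longrightarrow> j \<in> I \<Longrightarrow> \<exists>k\<in>I. (i, k) \<in> r \<and> (j, k) \<in> r"
  shows "\<exists>k\<in>I. \<forall>j\<in>J. (j, k) \<in> r"
  using assms(3,4)
proof (induction J)
  case empty
  then show ?case using assms(1) by auto
next
  case (insert j J)
  then obtain k where k: "k \<in> I" "\<forall>j\<in>J. (j, k) \<in> r" by auto
  obtain l where "l \<in> I" "(j, l) \<in> r" "(k, l) \<in> r"
    using assms(5)[of j k] insert.prems k(1) by auto
  then show ?case using k assms(2) by (metis insert_iff transE)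
qed

lemma closedin_compatible_pairs:
  assumes "i \<in> I" "j \<in> I" "h \<in> X j \<rightarrow> X i"
  shows "closedin (product_topology (\<lambda>i. discrete_topology (X i)) I)
           {x \<in> Pi\<^sub>E I X. h (x j) = x i}"
proof -
  let ?T = "product_topology (\<lambda>i. discrete_topology (X i)) I"
  have proj: "continuous_map ?T (discrete_topology (X k)) (\<lambda>x. x k)" if "k \<in> I" for k
    using continuous_map_product_projection[OF that, of "\<lambda>i. discrete_topology (X i)"] by simp
  have "continuous_map (discrete_topology (X j)) (discrete_topology (X i)) h"
    using assms(3) by simp
  then have "continuous_map ?T (discrete_topology (X i)) (\<lambda>x. h (x j))"
    using continuous_map_compose[OF proj[OF assms(2)], of "discrete_topology (X i)" h]
    by (simp add: o_def)
  from closedin_continuous_maps_eq[OF _ this proj[OF assms(1)]]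
  show ?thesis by (simp)
qed

lemma closedin_compatible_families:
  assumes "r \<subseteq> I \<times> I" "\<And>i j. (i, j) \<in> r \<Longrightarrow> \<phi> i j \<in> X j \<rightarrow> X i"
  shows "closedin (product_topology (\<lambda>i. discrete_topology (X i)) I)
           {x \<in> Pi\<^sub>E I X. \<forall>i j. (i, j) \<in> r \<longrightarrow> \<phi> i j (x j) = x i}"
proof -
  let ?T = "product_topology (\<lambda>i. discrete_topology (X i)) I"
  let ?E = "\<lambda>(i, j). {x \<in> Pi\<^sub>E I X. \<phi> i j (x j) = x i}"
  have "closedin ?T (\<Inter> (insert (topspace ?T) (?E ` r)))"
    using assms closedin_compatible_pairs[of _ I _ "\<phi> _ _" X]
      closedin_topspace[of ?T]
    by (intro closedin_Inter) (auto simp del: topspace_product_topology closedin_topspace)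
  also have "\<Inter> (insert (topspace ?T) (?E ` r)) =
      {x \<in> Pi\<^sub>E I X. \<forall>i j. (i, j) \<in> r \<longrightarrow> \<phi> i j (x j) = x i}"
    by auto
  finally show ?thesis .
qed

lemma compact_product_of_finite:
  assumes "\<And>i. i \<in> I \<Longrightarrow> finite (X i)"
  shows "compact_space (product_topology (\<lambda>i. discrete_topology (X i)) I)"
  using assms by (simp add: compact_space_product_topology compact_space_discrete_topology)

text \<open>
  Finitely many compatibility conditions only involve coordinates below a common bound \<open>k\<close>, and
  the images of any element of \<open>X k\<close> satisfy them; compactness of the product does the rest.
\<close>

lemma inverse_limit_of_finite_sets_nonempty:
  assumes I: "I \<noteq> {}" "r \<subseteq> I \<times> I" "trans r"
    and directed: "\<And>i j. i \<in> I \<Longrightarrow> j \<in> I \<Longrightarrow> \<exists>k\<in>I. (i, k) \<in> r \<and> (j, k) \<in> r"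
    and X: "\<And>i. i \<in> I \<Longrightarrow> finite (X i)" "\<And>i. i \<in> I \<Longrightarrow> X i \<noteq> {}"
    and maps: "\<And>i j. (i, j) \<in> r \<Longrightarrow> \<phi> i j \<in> X j \<rightarrow> X i"
    and comp: "\<And>i j k x. (i, j) \<in> r \<Longrightarrow> (j, k) \<in> r \<Longrightarrow> x \<in> X k \<Longrightarrow> \<phi> i j (\<phi> j k x) = \<phi> i k x"
  shows "\<exists>x\<in>Pi\<^sub>E I X. \<forall>i j. (i, j) \<in> r \<longrightarrow> \<phi> i j (x j) = x i"
proof -
  let ?T = "product_topology (\<lambda>i. discrete_topology (X i)) I"
  let ?E = "\<lambda>(i, j). {x \<in> Pi\<^sub>E I X. \<phi> i j (x j) = x i}"
  have "compact_space ?T" by (rule compact_product_of_finite) (rule X)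
  moreover have "(\<forall>E\<in>?E ` r. closedin ?T E) \<and>
      (\<forall>\<F>. finite \<F> \<and> \<F> \<subseteq> ?E ` r \<longrightarrow> \<Inter>\<F> \<noteq> {})"
  proof (intro conjI ballI allI impI)
    show "closedin ?T E" if "E \<in> ?E ` r" for E
      using that I(2) maps closedin_compatible_pairs[of _ I _ "\<phi> _ _" X] by auto
    fix \<F> assume "finite \<F> \<and> \<F> \<subseteq> ?E ` r"
    then obtain F where F: "F \<subseteq> r" "finite F" "\<F> = ?E ` F"
      by (meson finite_subset_image)
    have "\<exists>k\<in>I. \<forall>j\<in>fst ` F \<union> snd ` F. (j, k) \<in> r"
      using F I directed by (intro directed_finite_upper_bound) auto
    then obtain k where k: "k \<in> I" "\<And>i j. (i, j) \<in> F \<Longrightarrow> (i, k) \<in> r \<and> (j, k) \<in> r"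
      by force
    obtain a where a: "a \<in> X k" using X(2)[OF k(1)] by blast
    \<comment> \<open>Coordinates that are not below \<open>k\<close> occur in no condition of \<open>F\<close> and are arbitrary.\<close>
    define x where "x = (\<lambda>i\<in>I. if (i, k) \<in> r then \<phi> i k a else (SOME b. b \<in> X i))"
    have "x i \<in> X i" if "i \<in> I" for i
      using that maps[of i k] a some_in_eq[of "X i"] X(2)[of i] by (auto simp: x_def)
    moreover have "\<phi> i j (x j) = x i" if "(i, j) \<in> F" for i j
      using that k(2)[of i j] F(1) I(2) comp[of i j k a] a by (auto simp: x_def)
    moreover have "x \<in> extensional I" by (simp add: x_def)
    ultimately have "x \<in> ?E e" if "e \<in> F" for e
      using that by (auto simp: PiE_iff)
    then show "\<Inter> \<F> \<noteq> {}" using F(3) by blast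
  qed
  ultimately have "\<Inter> (?E ` r) \<noteq> {}"
    by (rule compact_space_fip[THEN iffD1, THEN spec, THEN mp])
  then obtain x where x: "\<And>e. e \<in> r \<Longrightarrow> x \<in> ?E e" by blast
  have "r \<noteq> {}" using I directed by blast
  then have "x \<in> Pi\<^sub>E I X" using x by fastforce
  moreover have "\<forall>i j. (i, j) \<in> r \<longrightarrow> \<phi> i j (x j) = x i" using x by fastforce
  ultimately show ?thesis by blast
qed


section \<open>Continuous homomorphisms into finite groups\<close>


lemma cont_hom_ext:
  assumes "f \<in> cont_hom G T P" "g \<in> cont_hom G T P" "\<And>x. x \<in> carrier G \<Longrightarrow> f x = g x"
  shows "f = g"
  using assms unfolding cont_hom_def by (auto intro: extensionalityI)

text \<open>
  Homomorphisms into a subgroup are homomorphisms into the whole group with a restricted range;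
  this lets the extensions into all subgroups of one group be counted inside a single finite set.
\<close>

lemma cont_hom_into_subgroup_iff:
  assumes "R \<subseteq> carrier P" "topspace T = carrier G"
  shows "f \<in> cont_hom G T (P\<lparr>carrier := R\<rparr>) \<longleftrightarrow>
         f \<in> cont_hom G T P \<and> f ` carrier G \<subseteq> R"
proof -
  have "continuous_map T (discrete_topology R) f \<longleftrightarrow>
      continuous_map T (discrete_topology (carrier P)) f \<and> f ` carrier G \<subseteq> R"
    using continuous_map_in_subtopology[of T "discrete_topology (carrier P)" R f] assms
    by (simp add: Int_absorb1 image_subset_iff_funcset)
  then show ?thesis
    using assms(1) unfolding cont_hom_def hom_def by auto
qed

lemma trivial_cont_hom:
  assumes "group G" "group P" "topspace T = carrier G"
  shows "(\<lambda>x\<in>carrier G. \<one>\<^bsub>P\<^esub>) \<in> cont_hom G T P"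
proof -
  interpret G: group G by fact
  interpret P: group P by fact
  have "continuous_map T (discrete_topology (carrier P)) (\<lambda>x\<in>carrier G. \<one>\<^bsub>P\<^esub>)"
    by (rule continuous_map_eq[of _ _ "\<lambda>x. \<one>\<^bsub>P\<^esub>"]) (auto simp: assms(3))
  then show ?thesis unfolding cont_hom_def by (auto simp: hom_def)
qed

lemma cont_hom_precompose:
  assumes "s \<in> hom G G'" "continuous_map T T' s" "\<psi> \<in> cont_hom G' T' P"
    and "group G" "topspace T = carrier G"
  shows "(\<lambda>x\<in>carrier G. \<psi> (s x)) \<in> cont_hom G T P"
proof -
  interpret G: group G by fact
  have "continuous_map T (discrete_topology (carrier P)) (\<psi> \<circ> s)"
    using assms(2,3) unfolding cont_hom_def by (blast intro: continuous_map_compose)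
  then have "continuous_map T (discrete_topology (carrier P)) (\<lambda>x\<in>carrier G. \<psi> (s x))"
    by (rule continuous_map_eq) (auto simp: assms(5))
  then show ?thesis
    using assms(1,3) unfolding cont_hom_def by (auto simp: hom_def Pi_iff)
qed

lemma cont_hom_postcompose:
  assumes "f \<in> cont_hom G T P" "h \<in> hom P Q" "group G" "topspace T = carrier G"
  shows "(\<lambda>x\<in>carrier G. h (f x)) \<in> cont_hom G T Q"
proof -
  interpret G: group G by fact
  have "continuous_map T (discrete_topology (carrier Q)) (h \<circ> f)"
    using assms(1,2) unfolding cont_hom_def
    by (auto intro!: continuous_map_compose[of T "discrete_topology (carrier P)"] simp: hom_def)
  then have "continuous_map T (discrete_topology (carrier Q)) (\<lambda>x\<in>carrier G. h (f x))"
    by (rule continuous_map_eq) (auto simp: assms(4))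
  then show ?thesis
    using assms(1,2) unfolding cont_hom_def by (auto simp: hom_def Pi_iff)
qed

lemma cont_hom_restrict:
  assumes "f \<in> cont_hom G T P" "subgroup K G"
  shows "restrict f K \<in> cont_hom_on G T K P"
proof -
  have "continuous_map (subtopology T K) (discrete_topology (carrier P)) (restrict f K)"
    using assms(1) unfolding cont_hom_def
    by (intro continuous_map_eq[OF continuous_map_from_subtopology]) auto
  then show ?thesis
    using assms subgroup.subset[OF assms(2)] subgroup.m_closed[OF assms(2)]
    unfolding cont_hom_def by (auto simp: hom_def Pi_iff subset_iff)
qed

lemma subgroup_equalizer:
  assumes "group G" "group P" "f \<in> hom G P" "g \<in> hom G P"
  shows "subgroup {x \<in> carrier G. f x = g x} G"
proof -
  interpret f: group_hom G P f using assms by (simp add: group_hom_def group_hom_axioms_def)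
  interpret g: group_hom G P g using assms by (simp add: group_hom_def group_hom_axioms_def)
  show ?thesis by (rule subgroup.intro) auto
qed

lemma closed_subgroup_equalizer:
  assumes "group G" "topspace T = carrier G" "group P" "f \<in> cont_hom G T P" "g \<in> cont_hom G T P"
  shows "closed_subgroup G T {x \<in> carrier G. f x = g x}"
  unfolding closed_subgroup_def
  using assms subgroup_equalizer[of G P f g]
    closedin_continuous_maps_eq[OF Hausdorff_space_discrete_topology, of T "carrier P" f g]
  by (auto simp: cont_hom_def)

text \<open>
  Two continuous homomorphisms that agree on a topological generating set agree on a closed
  subgroup containing it, hence everywhere. So there are at most as many as there are maps from a
  finite generating set to \<open>P\<close>.
\<close>

lemma finite_cont_hom:
  assumes "group G" "topspace T = carrier G" "top_finitely_generated G T"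
    and "group P" "finite (carrier P)"
  shows "finite (cont_hom G T P)"
proof -
  obtain S where S: "finite S" "S \<subseteq> carrier G" "T closure_of (generate G S) = carrier G"
    using assms(3) unfolding top_finitely_generated_def by auto
  have "inj_on (\<lambda>f. restrict f S) (cont_hom G T P)"
  proof (rule inj_onI)
    fix f g assume fg: "f \<in> cont_hom G T P" "g \<in> cont_hom G T P" "restrict f S = restrict g S"
    let ?D = "{x \<in> carrier G. f x = g x}"
    have D: "closed_subgroup G T ?D" by (rule closed_subgroup_equalizer) (use assms fg in auto)
    have "S \<subseteq> ?D" using S(2) fg(3) by (auto simp: restrict_def fun_eq_iff split: if_splits; metis)
    then have "generate G S \<subseteq> ?D"
      using D assms(1) group.generate_subgroup_incl unfolding closed_subgroup_def by blast
    then have "carrier G \<subseteq> ?D"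
      using D S(3) closure_of_minimal unfolding closed_subgroup_def by metis
    then show "f = g" using cont_hom_ext[OF fg(1,2)] by blast
  qed
  moreover have "(\<lambda>f. restrict f S) ` cont_hom G T P \<subseteq> S \<rightarrow>\<^sub>E carrier P"
    using S(2) by (auto simp: cont_hom_def hom_def)
  moreover have "finite (S \<rightarrow>\<^sub>E carrier P)" using S(1) assms(5) by (simp add: finite_PiE)
  ultimately show ?thesis by (meson finite_imageD finite_subset)
qed

definition constant_num_extensions ::
  "nat monoid set \<Rightarrow> 'a monoid \<Rightarrow> 'a topology \<Rightarrow> 'a set \<Rightarrow> bool"
  where "constant_num_extensions C G T H \<longleftrightarrow>
    (\<forall>P\<in>C. \<forall>\<gamma>\<^sub>1\<in>cont_hom_on G T H P. \<forall>\<gamma>\<^sub>2\<in>cont_hom_on G T H P.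
       num_extensions G T H \<gamma>\<^sub>1 P = num_extensions G T H \<gamma>\<^sub>2 P)"

lemma constant_num_extensionsD:
  assumes "constant_num_extensions C G T H" "P \<in> C"
    and "\<gamma> \<in> cont_hom_on G T H P" "\<gamma>' \<in> cont_hom_on G T H P"
  shows "num_extensions G T H \<gamma> P = num_extensions G T H \<gamma>' P"
  using assms unfolding constant_num_extensions_def by blast


section \<open>Counting homomorphisms by the subgroup they generate\<close>

text \<open>
  Moebius inversion over a family of finite sets, in the form of an induction on \<open>R\<close>: the number
  of objects with \<open>m x = R\<close> is the number with \<open>m x \<subseteq> R\<close> minus the numbers for the smaller
  members of the family.
\<close>

lemma card_eq_if_card_below_eq:
  assumes fin: "finite X" "finite Y" "\<And>R. R \<in> F \<Longrightarrow> finite R"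
    and m: "\<And>x. x \<in> X \<Longrightarrow> m x \<in> F" and n: "\<And>y. y \<in> Y \<Longrightarrow> n y \<in> F"
    and below: "\<And>R. R \<in> F \<Longrightarrow> card {x \<in> X. m x \<subseteq> R} = card {y \<in> Y. n y \<subseteq> R}"
    and "R \<in> F"
  shows "card {x \<in> X. m x = R} = card {y \<in> Y. n y = R}"
  using \<open>R \<in> F\<close>
proof (induction "card R" arbitrary: R rule: less_induct)
  case less
  let ?S = "{R' \<in> F. R' \<subset> R}"
  have "finite ?S"
    using fin(3)[OF less.prems] by (rule finite_subset[rotated, OF finite_Pow_iff[THEN iffD2]]) auto
  have split: "card {z \<in> Z. k z \<subseteq> R} = card {z \<in> Z. k z = R} + (\<Sum>R'\<in>?S. card {z \<in> Z. k z = R'})"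
    if Z: "finite Z" "\<And>z. z \<in> Z \<Longrightarrow> k z \<in> F" for Z :: "'z set" and k
  proof -
    have "{z \<in> Z. k z \<subseteq> R} = {z \<in> Z. k z = R} \<union> (\<Union>R'\<in>?S. {z \<in> Z. k z = R'})"
      using Z(2) by auto
    also have "card \<dots> = card {z \<in> Z. k z = R} + card (\<Union>R'\<in>?S. {z \<in> Z. k z = R'})"
      using Z(1) \<open>finite ?S\<close> by (intro card_Un_disjoint) auto
    also have "card (\<Union>R'\<in>?S. {z \<in> Z. k z = R'}) = (\<Sum>R'\<in>?S. card {z \<in> Z. k z = R'})"
      using Z(1) \<open>finite ?S\<close> by (intro card_UN_disjoint) auto
    finally show ?thesis .
  qed
  \<comment> \<open>The terms agree one by one, since every \<open>R'\<close> in the sum is a proper subset of \<open>R\<close>.\<close>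
  have "(\<Sum>R'\<in>?S. card {x \<in> X. m x = R'}) = (\<Sum>R'\<in>?S. card {y \<in> Y. n y = R'})"
    using psubset_card_mono[OF fin(3)[OF less.prems]]
    by (intro sum.cong refl less.hyps) auto
  then show ?case
    using split[of X m, OF fin(1) m] split[of Y n, OF fin(2) n] below[OF less.prems] by simp
qed

text \<open>
  The homomorphism \<open>q\<close> is found by comparing it with \<open>p\<close>. Both are classified by the subgroup that
  they generate together with \<open>p ` H\<close>. That this subgroup lies below \<open>R\<close> just means that the
  homomorphism maps into \<open>R\<close>, so the cumulative counts are numbers of extensions into \<open>R\<close>, and
  these agree for the trivial homomorphism on \<open>H\<close> and for the restriction of \<open>p\<close>.
\<close>

lemma exists_hom_generating_with_subgroup:
  assumes C: "pseudovariety C" and G: "group G" "topspace T = carrier G" "top_finitely_generated G T"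
    and H: "subgroup H G"
    and indep: "constant_num_extensions C G T H"
    and P: "P \<in> C" and p: "p \<in> cont_hom G T P"
  obtains q where "q \<in> cont_hom G T P" "\<And>x. x \<in> H \<Longrightarrow> q x = \<one>\<^bsub>P\<^esub>"
    "generate P (p ` H \<union> q ` carrier G) = p ` carrier G"
proof -
  interpret pseudovariety C by fact
  interpret P: group P using is_group[OF P] .
  interpret G: group G by fact
  interpret p: group_hom G P p
    using p by (simp add: group_hom_def group_hom_axioms_def cont_hom_def G.is_group P.is_group)
  have HG: "H \<subseteq> carrier G" using H by (rule subgroup.subset)
  have into: "f ` carrier G \<subseteq> carrier P" if "f \<in> cont_hom G T P" for f
    using that by (auto simp: cont_hom_def hom_def)
  define m where "m f = generate P (p ` H \<union> f ` carrier G)" for f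
  define F where "F = {R. subgroup R P \<and> p ` H \<subseteq> R}"
  define E where "E \<gamma> = {f \<in> cont_hom G T P. \<forall>x\<in>H. f x = \<gamma> x}" for \<gamma>
  let ?triv = "\<lambda>x\<in>H. \<one>\<^bsub>P\<^esub>"
  have m_F: "m f \<in> F" if "f \<in> cont_hom G T P" for f
  proof -
    have "p ` H \<union> f ` carrier G \<subseteq> carrier P" using into[OF that] into[OF p] HG by blast
    then show ?thesis
      unfolding F_def m_def using P.generate_is_subgroup by (auto intro: generate.incl)
  qed
  have fin: "finite (cont_hom G T P)"
    by (rule finite_cont_hom[OF G P.is_group is_finite[OF P]])
  have m_le: "m f \<subseteq> R \<longleftrightarrow> f ` carrier G \<subseteq> R" if "R \<in> F" for f R
  proof
    show "f ` carrier G \<subseteq> R" if "m f \<subseteq> R"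
      using that by (auto simp: m_def intro: generate.incl)
    show "m f \<subseteq> R" if "f ` carrier G \<subseteq> R"
      unfolding m_def using that \<open>R \<in> F\<close>
      by (intro P.generate_subgroup_incl) (auto simp: F_def)
  qed
  have below: "card {f \<in> E \<gamma>. m f \<subseteq> R} = num_extensions G T H \<gamma> (P\<lparr>carrier := R\<rparr>)"
    if "R \<in> F" for R \<gamma>
  proof -
    have R: "R \<subseteq> carrier P" using that by (simp add: F_def subgroup.subset)
    show ?thesis
      unfolding num_extensions_def E_def m_le[OF that] cont_hom_into_subgroup_iff[OF R G(2)]
      by (rule arg_cong[where f = card]) auto
  qed
  have "card {f \<in> E ?triv. m f = m p} = card {f \<in> E (restrict p H). m f = m p}"
  proof (rule card_eq_if_card_below_eq[where F = F])
    show "finite (E ?triv)" "finite (E (restrict p H))" unfolding E_def using fin by auto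
    show "finite R" if "R \<in> F" for R
      using that subgroup.subset[of R P] finite_subset[OF _ is_finite[OF P]] by (simp add: F_def)
    show "m f \<in> F" if "f \<in> E ?triv" for f using that m_F unfolding E_def by simp
    show "m f \<in> F" if "f \<in> E (restrict p H)" for f using that m_F unfolding E_def by simp
    show "m p \<in> F" using m_F p by simp
    fix R assume R: "R \<in> F"
    then have sub: "subgroup R P" "p ` H \<subseteq> R" by (auto simp: F_def)
    have top: "topspace (subtopology T H) = carrier (G\<lparr>carrier := H\<rparr>)"
      using HG G(2) by (simp add: Int_absorb1)
    have "?triv \<in> cont_hom_on G T H (P\<lparr>carrier := R\<rparr>)"
      using trivial_cont_hom[OF G.subgroup_imp_group[OF H] P.is_group top]
      unfolding cont_hom_into_subgroup_iff[OF subgroup.subset[OF sub(1)] top]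
      using subgroup.one_closed[OF sub(1)] by auto
    moreover have "restrict p H \<in> cont_hom_on G T H (P\<lparr>carrier := R\<rparr>)"
      using cont_hom_restrict[OF p H] sub(2)
      unfolding cont_hom_into_subgroup_iff[OF subgroup.subset[OF sub(1)] top] by auto
    ultimately show "card {f \<in> E ?triv. m f \<subseteq> R} = card {f \<in> E (restrict p H). m f \<subseteq> R}"
      unfolding below[OF R] 
      by (rule constant_num_extensionsD[OF indep subgroup_closed[OF P sub(1)]])
  qed
  moreover have "p \<in> {f \<in> E (restrict p H). m f = m p}" using p by (simp add: E_def)
  then have "card {f \<in> E (restrict p H). m f = m p} > 0"
    using fin by (subst card_gt_0_iff) (auto simp: E_def)
  ultimately obtain q where q: "q \<in> E ?triv" "m q = m p"
    by (metis (mono_tags, lifting) card.empty empty_Collect_eq less_irrefl)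
  have "p ` H \<union> p ` carrier G = p ` carrier G" using HG by auto
  then have "m p = p ` carrier G"
    unfolding m_def using P.generateI[OF p.img_is_subgroup] by (metis order_refl)
  then show thesis using that[of q] q by (auto simp: E_def m_def)
qed


section \<open>Pro-\<open>C\<close> groups through their finite coordinates\<close>

lemma inverse_systemD:
  assumes "inverse_system I r A \<phi>"
  shows "I \<noteq> {}" "r \<subseteq> I \<times> I" "trans r"
    and "\<And>i j. i \<in> I \<Longrightarrow> j \<in> I \<Longrightarrow> \<exists>k\<in>I. (i, k) \<in> r \<and> (j, k) \<in> r"
    and "\<And>i. i \<in> I \<Longrightarrow> group (A i)"
    and "\<And>i j. (i, j) \<in> r \<Longrightarrow> \<phi> i j \<in> hom (A j) (A i)"
    and "\<And>i j k x. (i, j) \<in> r \<Longrightarrow> (j, k) \<in> r \<Longrightarrow> x \<in> carrier (A k) \<Longrightarrow> \<phi> i j (\<phi> j k x) = \<phi> i k x"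
proof -
  have "partial_order_on I r" using assms unfolding inverse_system_def by blast
  then show "r \<subseteq> I \<times> I" "trans r" by (simp_all add: partial_order_onD)
qed (use assms[unfolded inverse_system_def] in blast)+

text \<open>
  The form in which the presentation of a pro-\<open>C\<close> group as an inverse limit is used: \<open>p i\<close> is the
  projection to the finite group \<open>A i\<close> (not necessarily onto), fibres of single projections
  form a base of the topology, and a compatible family of homomorphisms from \<open>G\<close> to the groups
  \<open>A i\<close> comes from an endomorphism of \<open>G\<close>.
\<close>

locale finite_coordinates =
  fixes G :: "'a monoid" and T :: "'a topology" and I r
    and A :: "'i \<Rightarrow> nat monoid" and \<phi> and p :: "'i \<Rightarrow> 'a \<Rightarrow> nat"
  assumes group_G: "group G" and topspace_T: "topspace T = carrier G"
    and compact_T: "compact_space T" and Hausdorff_T: "Hausdorff_space T"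
    and system: "inverse_system I r A \<phi>" and finite_A: "\<And>i. i \<in> I \<Longrightarrow> finite (carrier (A i))"
    and p_hom: "\<And>i. i \<in> I \<Longrightarrow> p i \<in> cont_hom G T (A i)"
    and p_compatible: "\<And>i j x. (i, j) \<in> r \<Longrightarrow> x \<in> carrier G \<Longrightarrow> \<phi> i j (p j x) = p i x"
    and p_nbhd: "\<And>U x. openin T U \<Longrightarrow> x \<in> U \<Longrightarrow> \<exists>i\<in>I. \<forall>y\<in>carrier G. p i y = p i x \<longrightarrow> y \<in> U"
    and p_lift: "\<And>q. \<lbrakk>\<And>i. i \<in> I \<Longrightarrow> q i \<in> cont_hom G T (A i);
        \<And>i j x. (i, j) \<in> r \<Longrightarrow> x \<in> carrier G \<Longrightarrow> \<phi> i j (q j x) = q i x\<rbrakk> \<Longrightarrow>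
        \<exists>s\<in>hom G G. continuous_map T T s \<and> (\<forall>i\<in>I. \<forall>x\<in>carrier G. p i (s x) = q i x)"
begin

lemmas systemD = inverse_systemD[OF system]

lemma p_separates:
  assumes "x \<in> carrier G" "y \<in> carrier G" "\<And>i. i \<in> I \<Longrightarrow> p i x = p i y"
  shows "x = y"
proof (rule ccontr)
  assume "x \<noteq> y"
  have "openin T (topspace T - {y})"
    using closedin_Hausdorff_sing_eq[OF Hausdorff_T] assms(2) topspace_T
    by (intro openin_diff openin_topspace) simp
  moreover have "x \<in> topspace T - {y}" using assms(1) topspace_T \<open>x \<noteq> y\<close> by simp
  ultimately obtain i where "i \<in> I" "\<forall>z\<in>carrier G. p i z = p i x \<longrightarrow> z \<in> topspace T - {y}"
    using p_nbhd by meson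
  then show False using assms(2,3) by force
qed

text \<open>
  A point outside a closed set \<open>D\<close> has a neighbourhood disjoint from \<open>D\<close> that is a fibre of some
  \<open>p i\<close>, so it is already separated from \<open>D\<close> in the \<open>i\<close>-th coordinate.
\<close>

lemma closed_subset_eq_carrier:
  assumes D: "closedin T D" and full: "\<And>i. i \<in> I \<Longrightarrow> p i ` carrier G \<subseteq> p i ` D"
  shows "D = carrier G"
proof (rule ccontr)
  assume "D \<noteq> carrier G"
  then obtain x where x: "x \<in> topspace T - D"
    using closedin_subset[OF D] topspace_T by auto
  obtain i where i: "i \<in> I" "\<And>y. y \<in> carrier G \<Longrightarrow> p i y = p i x \<Longrightarrow> y \<in> topspace T - D"
    using p_nbhd[OF openin_diff[OF openin_topspace D] x] by auto
  obtain y where "y \<in> D" "p i y = p i x" using full[OF i(1)] x topspace_T by auto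
  then show False using i(2)[of y] closedin_subset[OF D] topspace_T by auto
qed

text \<open>
  The solutions \<open>q\<close> of the problem in the finite groups \<open>A i\<close> form an inverse system of finite
  nonempty sets: a homomorphism \<open>\<phi> i j\<close> commutes with forming generated subgroups, so it carries
  solutions for \<open>j\<close> to solutions for \<open>i\<close>. A compatible family of solutions is the endomorphism
  \<open>s\<close>. The last conclusion says that \<open>H\<close> and the image of \<open>s\<close> generate a dense subgroup.
\<close>

lemma exists_endomorphism_generating_with_subgroup:
  assumes C: "pseudovariety C" "A ` I \<subseteq> C"
    and fg: "top_finitely_generated G T" and H: "subgroup H G"
    and indep: "constant_num_extensions C G T H"
  obtains s where "s \<in> hom G G" "continuous_map T T s" "\<And>x. x \<in> H \<Longrightarrow> s x = \<one>\<^bsub>G\<^esub>"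
    "\<And>D. closed_subgroup G T D \<Longrightarrow> H \<subseteq> D \<Longrightarrow> s ` carrier G \<subseteq> D \<Longrightarrow> D = carrier G"
proof -
  interpret G: group G by (rule group_G)
  have HG: "H \<subseteq> carrier G" using H by (rule subgroup.subset)
  define S where "S i = {q \<in> cont_hom G T (A i). (\<forall>x\<in>H. q x = \<one>\<^bsub>A i\<^esub>) \<and>
      generate (A i) (p i ` H \<union> q ` carrier G) = p i ` carrier G}" for i
  define push where "push i j q = (\<lambda>x\<in>carrier G. \<phi> i j (q x))" for i j and q :: "'a \<Rightarrow> nat"
  have "\<exists>q\<in>Pi\<^sub>E I S. \<forall>i j. (i, j) \<in> r \<longrightarrow> push i j (q j) = q i"
  proof (rule inverse_limit_of_finite_sets_nonempty[OF systemD(1-4), of S push])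
    show "finite (S i)" if "i \<in> I" for i
      using finite_cont_hom[OF group_G topspace_T fg systemD(5)[OF that] finite_A[OF that]]
      by (simp add: S_def)
    show "S i \<noteq> {}" if i: "i \<in> I" for i
    proof -
      have "A i \<in> C" using C(2) i by blast
      obtain q where "q \<in> cont_hom G T (A i)" "\<And>x. x \<in> H \<Longrightarrow> q x = \<one>\<^bsub>A i\<^esub>"
        "generate (A i) (p i ` H \<union> q ` carrier G) = p i ` carrier G"
        by (rule exists_hom_generating_with_subgroup[OF C(1) group_G topspace_T fg H indep
              \<open>A i \<in> C\<close> p_hom[OF i]]) (rule that)
      then have "q \<in> S i" by (simp add: S_def)
      then show ?thesis by blast
    qed
    show "push i j \<in> S j \<rightarrow> S i" if ij: "(i, j) \<in> r" for i j
    proof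
      fix q assume q: "q \<in> S j"
      have I: "i \<in> I" "j \<in> I" using ij systemD(2) by auto
      interpret \<phi>: group_hom "A j" "A i" "\<phi> i j"
        using systemD(5)[OF I(1)] systemD(5)[OF I(2)] systemD(6)[OF ij]
        by (simp add: group_hom_def group_hom_axioms_def)
      have into: "q ` carrier G \<subseteq> carrier (A j)" "p j ` carrier G \<subseteq> carrier (A j)"
        using q p_hom[OF I(2)] by (auto simp: S_def cont_hom_def hom_def)
      have "push i j q \<in> cont_hom G T (A i)"
        unfolding push_def using q
        by (intro cont_hom_postcompose[OF _ systemD(6)[OF ij] group_G topspace_T])
          (simp add: S_def)
      moreover have "push i j q x = \<one>\<^bsub>A i\<^esub>" if "x \<in> H" for x
        using that q HG by (auto simp: push_def S_def)
      moreover have "generate (A i) (p i ` H \<union> push i j q ` carrier G) = p i ` carrier G"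
      proof -
        have img: "p i ` X = \<phi> i j ` p j ` X" if "X \<subseteq> carrier G" for X
          unfolding image_image
          by (rule image_cong) (use that p_compatible[OF ij] in auto)
        have "push i j q ` carrier G = \<phi> i j ` q ` carrier G"
          by (auto simp: push_def image_image)
        then have "p i ` H \<union> push i j q ` carrier G = \<phi> i j ` (p j ` H \<union> q ` carrier G)"
          by (simp only: image_Un img[OF HG])
        moreover have "p j ` H \<union> q ` carrier G \<subseteq> carrier (A j)" using into HG by auto
        ultimately have "generate (A i) (p i ` H \<union> push i j q ` carrier G) =
            \<phi> i j ` generate (A j) (p j ` H \<union> q ` carrier G)"
          using \<phi>.generate_img[of "p j ` H \<union> q ` carrier G"] by simp
        also have "generate (A j) (p j ` H \<union> q ` carrier G) = p j ` carrier G"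
          using q by (simp add: S_def)
        finally show ?thesis by (simp only: img[OF order_refl])
      qed
      ultimately show "push i j q \<in> S i" by (simp add: S_def)
    qed
    show "push i j (push j k q) = push i k q" if "(i, j) \<in> r" "(j, k) \<in> r" "q \<in> S k" for i j k q
      using that systemD(7)[OF that(1,2)]
      by (auto simp: push_def S_def cont_hom_def hom_def Pi_iff)
  qed
  then obtain q where q: "q \<in> Pi\<^sub>E I S" "\<And>i j. (i, j) \<in> r \<Longrightarrow> push i j (q j) = q i"
    by blast
  have qS: "q i \<in> S i" if "i \<in> I" for i using q(1) that by auto
  have "\<exists>s\<in>hom G G. continuous_map T T s \<and> (\<forall>i\<in>I. \<forall>x\<in>carrier G. p i (s x) = q i x)"
  proof (rule p_lift)
    show "q i \<in> cont_hom G T (A i)" if "i \<in> I" for i using qS[OF that] by (simp add: S_def)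
    show "\<phi> i j (q j x) = q i x" if "(i, j) \<in> r" "x \<in> carrier G" for i j x
      using fun_cong[OF q(2)[OF that(1)], of x] that(2) by (simp add: push_def)
  qed
  then obtain s where s: "s \<in> hom G G" "continuous_map T T s"
    and ps: "\<And>i x. i \<in> I \<Longrightarrow> x \<in> carrier G \<Longrightarrow> p i (s x) = q i x" by blast
  have p_group_hom: "group_hom G (A i) (p i)" if "i \<in> I" for i
    using p_hom[OF that] systemD(5)[OF that] group_G
    by (simp add: group_hom_def group_hom_axioms_def cont_hom_def)
  show thesis
  proof (rule that[OF s])
    fix x assume "x \<in> H"
    then have x: "x \<in> carrier G" using HG by auto
    show "s x = \<one>\<^bsub>G\<^esub>"
    proof (rule p_separates)
      show "p i (s x) = p i \<one>\<^bsub>G\<^esub>" if "i \<in> I" for i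
        using ps[OF that x] qS[OF that] \<open>x \<in> H\<close> group_hom.hom_one[OF p_group_hom[OF that]]
        by (simp add: S_def)
    qed (use s(1) x in \<open>auto simp: hom_def\<close>)
  next
    fix D assume D: "closed_subgroup G T D" "H \<subseteq> D" "s ` carrier G \<subseteq> D"
    show "D = carrier G"
    proof (rule closed_subset_eq_carrier)
      show "closedin T D" using D(1) by (simp add: closed_subgroup_def)
      fix i assume i: "i \<in> I"
      interpret Ai: group "A i" by (rule systemD(5)[OF i])
      have "q i ` carrier G = p i ` s ` carrier G"
        unfolding image_image by (rule image_cong) (use ps[OF i] in auto)
      then have "p i ` H \<union> q i ` carrier G \<subseteq> p i ` D" using D(2,3) by auto
      moreover have "subgroup (p i ` D) (A i)"
        using group_hom.subgroup_img_is_subgroup[OF p_group_hom[OF i]] D(1)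
        by (simp add: closed_subgroup_def)
      ultimately have "generate (A i) (p i ` H \<union> q i ` carrier G) \<subseteq> p i ` D"
        by (rule Ai.generate_subgroup_incl)
      then show "p i ` carrier G \<subseteq> p i ` D" using qS[OF i] by (simp add: S_def)
    qed
  qed
qed

end

lemma pro_C_group_finite_coordinates:
  fixes G :: "'a monoid" (structure)
  assumes "pseudovariety C" "pro_C_group C G T"
  shows "\<exists>(I :: 'a set set) r A \<phi> p. finite_coordinates G T I r A \<phi> p \<and> A ` I \<subseteq> C"
proof -
  interpret pseudovariety C by fact
  obtain I :: "'a set set" and r A \<phi> f where top_group: "topological_group G T"
    and system: "inverse_system I r A \<phi>" and AC: "\<forall>i\<in>I. A i \<in> C"
    and f_iso: "f \<in> iso G (inverse_limit I r A \<phi>)"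
    and f_homeo: "homeomorphic_map T (inverse_limit_topology I r A \<phi>) f"
    using assms(2) unfolding pro_C_group_def by (elim conjE exE) (rule that)
  interpret topological_group G T by fact
  let ?L = "inverse_limit I r A \<phi>" and ?LT = "inverse_limit_topology I r A \<phi>"
  let ?X = "product_topology (\<lambda>i. discrete_topology (carrier (A i))) I"
  note sys = inverse_systemD[OF system]
  have L: "carrier ?L = {x \<in> Pi\<^sub>E I (\<lambda>i. carrier (A i)). \<forall>i j. (i, j) \<in> r \<longrightarrow> \<phi> i j (x j) = x i}"
    by (simp add: inverse_limit_def)
  have L_mult: "x \<otimes>\<^bsub>?L\<^esub> y = (\<lambda>i\<in>I. x i \<otimes>\<^bsub>A i\<^esub> y i)" for x y
    by (simp add: inverse_limit_def)
  have L_closed: "closedin ?X (carrier ?L)"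
    unfolding L using sys(2,6) by (intro closedin_compatible_families) (auto simp: hom_def)
  have X_compact: "compact_space ?X"
    by (rule compact_product_of_finite) (use AC is_finite in simp)
  have T_LT: "T homeomorphic_space ?LT"
    using f_homeo homeomorphic_map_imp_homeomorphic_space by blast
  have f_into: "f x \<in> carrier ?L" if "x \<in> carrier G" for x
    using f_iso that by (auto simp: iso_def hom_def)
  have f_mult: "f (x \<otimes> y) i = f x i \<otimes>\<^bsub>A i\<^esub> f y i" if "x \<in> carrier G" "y \<in> carrier G" "i \<in> I" for x y i
    using f_iso that by (auto simp: iso_def hom_def L_mult)
  have f_cont: "continuous_map T ?X f"
    using homeomorphic_imp_continuous_map[OF f_homeo]
    by (simp add: inverse_limit_topology_def continuous_map_in_subtopology)
  obtain g where g: "homeomorphic_maps T ?LT f g"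
    using f_homeo homeomorphic_map_maps by blast
  have LT: "topspace ?LT = carrier ?L"
    using closedin_subset[OF L_closed] by (simp add: inverse_limit_topology_def Int_absorb1)
  have gf: "g (f x) = x" if "x \<in> carrier G" for x
    using g that topspace_eq by (auto simp: homeomorphic_maps_def)
  have fg: "f (g y) = y" and g_into: "g y \<in> carrier G" if "y \<in> carrier ?L" for y
    using g that LT topspace_eq by (auto simp: homeomorphic_maps_def continuous_map_def)
  define p where "p i = (\<lambda>x\<in>carrier G. f x i)" for i
  have "finite_coordinates G T I r A \<phi> p"
  proof (rule finite_coordinates.intro)
    show "group G" by (rule is_group)
    show "topspace T = carrier G" by (rule topspace_eq)
    show "compact_space T"
      unfolding homeomorphic_compact_space[OF T_LT] inverse_limit_topology_def
      by (intro compact_space_subtopology closedin_compact_space X_compact L_closed)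
    show "Hausdorff_space T"
      unfolding homeomorphic_Hausdorff_space[OF T_LT] inverse_limit_topology_def
      by (intro Hausdorff_space_subtopology) (simp add: Hausdorff_space_product_topology)
    show "inverse_system I r A \<phi>" by fact
    show "finite (carrier (A i))" if "i \<in> I" for i using AC is_finite that by blast
    show "p i \<in> cont_hom G T (A i)" if i: "i \<in> I" for i
    proof -
      have "continuous_map T (discrete_topology (carrier (A i))) (\<lambda>x. f x i)"
        using f_cont i by (simp add: continuous_map_componentwise)
      then have "continuous_map T (discrete_topology (carrier (A i))) (p i)"
        by (rule continuous_map_eq) (simp add: p_def topspace_eq)
      then show ?thesis
        using i f_into f_mult unfolding cont_hom_def
        by (auto simp: hom_def p_def L PiE_iff)
    qed
    show "\<phi> i j (p j x) = p i x" if "(i, j) \<in> r" "x \<in> carrier G" for i j x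
      using that f_into[of x] by (auto simp: p_def L)
  next
    \<comment> \<open>A basic open set restricts finitely many coordinates, and all of them are determined by
      the coordinate at a common upper bound \<open>k\<close>.\<close>
    fix U x assume U: "openin T U" "x \<in> U"
    then have x: "x \<in> carrier G" using openin_subset topspace_eq by blast
    have "openin ?LT (f ` U)"
      using f_homeo U(1) homeomorphic_map_openness openin_subset by blast
    then obtain V where V: "openin ?X V" "f ` U = V \<inter> carrier ?L"
      unfolding inverse_limit_topology_def openin_subtopology by auto
    have "f x \<in> V" using V(2) U(2) by blast
    obtain W where W: "finite {i \<in> I. W i \<noteq> carrier (A i)}"
      "f x \<in> Pi\<^sub>E I W" "Pi\<^sub>E I W \<subseteq> V"
      using V(1)[unfolded openin_product_topology_alt, rule_format, OF \<open>f x \<in> V\<close>] by auto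
    obtain k where k: "k \<in> I" "\<And>i. i \<in> I \<Longrightarrow> W i \<noteq> carrier (A i) \<Longrightarrow> (i, k) \<in> r"
      using directed_finite_upper_bound[OF sys(1,3) W(1) _ sys(4)] by auto
    have "y \<in> U" if y: "y \<in> carrier G" "p k y = p k x" for y
    proof -
      have "f y i \<in> W i" if i: "i \<in> I" for i
      proof (cases "W i = carrier (A i)")
        case True
        then show ?thesis using f_into[OF y(1)] i by (auto simp: L)
      next
        case False
        then have "(i, k) \<in> r" using k(2) i by blast
        then have "f y i = f x i"
          using f_into[OF x] f_into[OF y(1)] y x by (auto simp: L p_def) metis
        then show ?thesis using W(2) i by auto
      qed
      then have "f y \<in> Pi\<^sub>E I W" using f_into[OF y(1)] by (auto simp: L PiE_iff)
      then have "f y \<in> V \<inter> carrier ?L" using W(3) f_into[OF y(1)] by blast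
      then obtain u where "u \<in> U" "f y = f u" using V(2) by blast
      moreover have "u \<in> carrier G" using \<open>u \<in> U\<close> U(1) openin_subset topspace_eq by blast
      ultimately show ?thesis using gf y(1) by metis
    qed
    then show "\<exists>i\<in>I. \<forall>y\<in>carrier G. p i y = p i x \<longrightarrow> y \<in> U" using k(1) by blast
  next
    fix q assume q_hom: "\<And>i. i \<in> I \<Longrightarrow> q i \<in> cont_hom G T (A i)"
      and q_comp: "\<And>i j x. (i, j) \<in> r \<Longrightarrow> x \<in> carrier G \<Longrightarrow> \<phi> i j (q j x) = q i x"
    define h where "h x = (\<lambda>i\<in>I. q i x)" for x
    have h_into: "h x \<in> carrier ?L" if "x \<in> carrier G" for x
    proof -
      have "q i x \<in> carrier (A i)" if "i \<in> I" for i
        using q_hom[OF that] \<open>x \<in> carrier G\<close> by (auto simp: cont_hom_def hom_def)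
      then show ?thesis using q_comp that sys(2) by (auto simp: L h_def)
    qed
    have "continuous_map T ?X h"
      using q_hom by (auto simp: continuous_map_componentwise h_def cont_hom_def)
    then have "continuous_map T ?LT h"
      unfolding inverse_limit_topology_def
      using h_into topspace_eq by (intro continuous_map_into_subtopology) auto
    then have cont: "continuous_map T T (g \<circ> h)"
      using g continuous_map_compose unfolding homeomorphic_maps_def by blast
    have "g \<circ> h \<in> hom G G"
    proof (rule homI)
      fix x y assume xy: "x \<in> carrier G" "y \<in> carrier G"
      show "(g \<circ> h) x \<in> carrier G" using g_into[OF h_into[OF xy(1)]] by simp
      have "f (g (h x) \<otimes> g (h y)) = f (g (h x)) \<otimes>\<^bsub>?L\<^esub> f (g (h y))"
        using f_iso g_into h_into xy by (simp add: iso_def hom_def)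
      also have "\<dots> = h (x \<otimes> y)"
        using q_hom xy unfolding fg[OF h_into[OF xy(1)]] fg[OF h_into[OF xy(2)]] L_mult
        by (auto simp: h_def cont_hom_def hom_def)
      finally have "h (x \<otimes> y) = f (g (h x) \<otimes> g (h y))" ..
      then show "(g \<circ> h) (x \<otimes> y) = (g \<circ> h) x \<otimes> (g \<circ> h) y"
        using gf[of "g (h x) \<otimes> g (h y)"] g_into h_into xy by simp
    qed
    moreover have "p i ((g \<circ> h) x) = q i x" if "i \<in> I" "x \<in> carrier G" for i x
      using that fg[OF h_into] g_into[OF h_into] by (simp add: p_def h_def)
    ultimately show "\<exists>s\<in>hom G G. continuous_map T T s \<and>
        (\<forall>i\<in>I. \<forall>x\<in>carrier G. p i (s x) = q i x)"
      using cont by blast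
  qed
  moreover have "A ` I \<subseteq> C" using AC by blast
  ultimately show ?thesis by blast
qed


section \<open>Free factors and numbers of extensions\<close>

lemma num_extensions_free_product:
  assumes "is_free_pro_C_product C G T H K" "P \<in> C" "\<gamma> \<in> cont_hom_on G T H P"
  shows "num_extensions G T H \<gamma> P = card (cont_hom_on G T K P)"
proof -
  have K: "subgroup K G"
    and univ: "\<And>\<psi>. \<psi> \<in> cont_hom_on G T K P \<Longrightarrow>
      \<exists>!f. f \<in> cont_hom G T P \<and> (\<forall>x\<in>H. f x = \<gamma> x) \<and> (\<forall>x\<in>K. f x = \<psi> x)"
    using assms unfolding is_free_pro_C_product_def closed_subgroup_def by auto
  have "bij_betw (\<lambda>f. restrict f K) {f \<in> cont_hom G T P. \<forall>x\<in>H. f x = \<gamma> x} (cont_hom_on G T K P)"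
    unfolding bij_betw_def
  proof (intro conjI inj_onI equalityI subsetI)
    fix f f' assume ff: "f \<in> {f \<in> cont_hom G T P. \<forall>x\<in>H. f x = \<gamma> x}"
      "f' \<in> {f \<in> cont_hom G T P. \<forall>x\<in>H. f x = \<gamma> x}" "restrict f K = restrict f' K"
    have f: "f \<in> cont_hom G T P \<and> (\<forall>x\<in>H. f x = \<gamma> x) \<and> (\<forall>x\<in>K. f x = restrict f K x)"
      using ff(1) by simp
    have f': "f' \<in> cont_hom G T P \<and> (\<forall>x\<in>H. f' x = \<gamma> x) \<and> (\<forall>x\<in>K. f' x = restrict f K x)"
      using ff(2,3) by simp
    have "restrict f K \<in> cont_hom_on G T K P" using cont_hom_restrict[OF _ K] f by blast
    from univ[OF this] f f' show "f = f'" by blast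
  next
    fix \<psi> assume \<psi>: "\<psi> \<in> cont_hom_on G T K P"
    then obtain f where f: "f \<in> cont_hom G T P" "\<forall>x\<in>H. f x = \<gamma> x" "\<forall>x\<in>K. f x = \<psi> x"
      using univ by blast
    then have "restrict f K = \<psi>"
      using cont_hom_ext[OF cont_hom_restrict[OF f(1) K] \<psi>] by simp
    then show "\<psi> \<in> (\<lambda>f. restrict f K) ` {f \<in> cont_hom G T P. \<forall>x\<in>H. f x = \<gamma> x}"
      using f by blast
  qed (use cont_hom_restrict K in blast)
  then show ?thesis unfolding num_extensions_def by (rule bij_betw_same_card)
qed

text \<open>
  Existence of the common extension of \<open>\<psi>1\<close> and \<open>\<psi>2\<close> is obtained by counting. Injections
  run from the extensions of \<open>\<psi>1\<close> to \<open>Hom(K, P)\<close> (restriction) and from there to the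
  extensions of the trivial homomorphism (composition with \<open>s\<close>); the two outer sets have the same
  finite cardinality, which makes the restriction map onto.
\<close>

lemma free_product_with_image:
  assumes C: "pseudovariety C"
    and G: "group G" "topspace T = carrier G" "compact_space T" "Hausdorff_space T"
      "top_finitely_generated G T"
    and H: "closed_subgroup G T H"
    and s: "s \<in> hom G G" "continuous_map T T s" "\<And>x. x \<in> H \<Longrightarrow> s x = \<one>\<^bsub>G\<^esub>"
    and dense: "\<And>D. closed_subgroup G T D \<Longrightarrow> H \<subseteq> D \<Longrightarrow> s ` carrier G \<subseteq> D \<Longrightarrow> D = carrier G"
    and indep: "constant_num_extensions C G T H"
  shows "is_free_pro_C_product C G T H (s ` carrier G)"
proof -
  interpret pseudovariety C by fact
  interpret G: group G by fact
  interpret s: group_hom G G s using s(1) G(1) by (simp add: group_hom_def group_hom_axioms_def)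
  define K where "K = s ` carrier G"
  have K: "subgroup K G" unfolding K_def by (rule s.img_is_subgroup)
  have "compactin T K"
    unfolding K_def using image_compactin[OF _ s(2)] G(2,3) by (metis compact_space_def)
  then have K_closed: "closed_subgroup G T K"
    unfolding closed_subgroup_def using K compactin_imp_closedin[OF G(4)] by blast
  have HG: "subgroup H G" using H by (simp add: closed_subgroup_def)
  have "\<exists>!\<psi>. \<psi> \<in> cont_hom G T P \<and> (\<forall>x\<in>H. \<psi> x = \<psi>1 x) \<and> (\<forall>x\<in>K. \<psi> x = \<psi>2 x)"
    if P: "P \<in> C" and \<psi>1: "\<psi>1 \<in> cont_hom_on G T H P" and \<psi>2: "\<psi>2 \<in> cont_hom_on G T K P" for P \<psi>1 \<psi>2
  proof -
    interpret P: group P by (rule is_group[OF P])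
    let ?triv = "\<lambda>x\<in>H. \<one>\<^bsub>P\<^esub>" and ?B = "cont_hom_on G T K P"
    define E where "E \<gamma> = {f \<in> cont_hom G T P. \<forall>x\<in>H. f x = \<gamma> x}" for \<gamma>
    have fin: "finite (E \<gamma>)" for \<gamma>
      using finite_cont_hom[OF G(1,2,5) P.is_group is_finite[OF P]] by (simp add: E_def)
    have unique: "f = f'" if ff: "f \<in> cont_hom G T P" "f' \<in> cont_hom G T P"
      and eq: "\<forall>x\<in>H. f x = f' x" "\<forall>x\<in>K. f x = f' x" for f f'
    proof -
      have "{x \<in> carrier G. f x = f' x} = carrier G"
      proof (rule dense)
        show "closed_subgroup G T {x \<in> carrier G. f x = f' x}"
          by (rule closed_subgroup_equalizer) (use G ff P.is_group in auto)
      qed (use eq subgroup.subset[OF HG] subgroup.subset[OF K] in \<open>auto simp: K_def\<close>)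
      then show ?thesis using cont_hom_ext[OF ff] by blast
    qed
    have triv: "?triv \<in> cont_hom_on G T H P"
      using trivial_cont_hom[OF G.subgroup_imp_group[OF HG] P.is_group, of "subtopology T H"]
        subgroup.subset[OF HG] G(2) by (simp add: Int_absorb1)
    have inj1: "inj_on (\<lambda>f. restrict f K) (E \<psi>1)"
    proof (rule inj_onI)
      fix f f' assume "f \<in> E \<psi>1" "f' \<in> E \<psi>1" and res: "restrict f K = restrict f' K"
      moreover have "\<forall>x\<in>K. f x = f' x" using res by (metis restrict_apply')
      ultimately show "f = f'" using unique[of f f'] by (auto simp: E_def)
    qed
    have s_cont: "continuous_map T (subtopology T K) s"
      using s(2) G(2) by (auto intro: continuous_map_into_subtopology simp: K_def)
    have s_hom: "s \<in> hom G (G\<lparr>carrier := K\<rparr>)"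
      using s(1) by (auto simp: hom_def K_def)
    have inj2: "inj_on (\<lambda>\<psi>. \<lambda>x\<in>carrier G. \<psi> (s x)) ?B"
    proof (rule inj_onI)
      fix \<psi> \<psi>' assume \<psi>: "\<psi> \<in> ?B" "\<psi>' \<in> ?B"
        and eq: "(\<lambda>x\<in>carrier G. \<psi> (s x)) = (\<lambda>x\<in>carrier G. \<psi>' (s x))"
      show "\<psi> = \<psi>'"
      proof (rule cont_hom_ext[OF \<psi>])
        fix y assume "y \<in> carrier (G\<lparr>carrier := K\<rparr>)"
        then obtain x where "x \<in> carrier G" "y = s x" by (auto simp: K_def)
        then show "\<psi> y = \<psi>' y" using fun_cong[OF eq, of x] by simp
      qed
    qed
    have "(\<lambda>\<psi>. \<lambda>x\<in>carrier G. \<psi> (s x)) ` ?B \<subseteq> E ?triv"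
    proof clarify
      fix \<psi> assume \<psi>: "\<psi> \<in> ?B"
      then have "\<psi> \<one>\<^bsub>G\<^esub> = \<one>\<^bsub>P\<^esub>"
        using hom_one[of \<psi> "G\<lparr>carrier := K\<rparr>" P] G.subgroup_imp_group[OF K] P.is_group
        by (simp add: cont_hom_def)
      then show "(\<lambda>x\<in>carrier G. \<psi> (s x)) \<in> E ?triv"
        using cont_hom_precompose[OF s_hom s_cont \<psi> G(1,2)] s(3) subgroup.subset[OF HG]
        by (auto simp: E_def)
    qed
    then have B: "finite ?B" "card ?B \<le> card (E ?triv)"
      using inj2 fin inj_on_finite card_inj_on_le by blast+
    have "card (E ?triv) = card (E \<psi>1)"
      using constant_num_extensionsD[OF indep P triv \<psi>1] by (simp add: num_extensions_def E_def)
    then have "card ?B \<le> card ((\<lambda>f. restrict f K) ` E \<psi>1)"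
      using B(2) card_image[OF inj1] by simp
    moreover have "(\<lambda>f. restrict f K) ` E \<psi>1 \<subseteq> ?B"
      using cont_hom_restrict[OF _ K] by (auto simp: E_def)
    ultimately have "(\<lambda>f. restrict f K) ` E \<psi>1 = ?B"
      using card_seteq[OF B(1)] by blast
    then obtain f where "f \<in> E \<psi>1" "\<psi>2 = restrict f K" using \<psi>2 by blast
    then have f: "f \<in> cont_hom G T P \<and> (\<forall>x\<in>H. f x = \<psi>1 x) \<and> (\<forall>x\<in>K. f x = \<psi>2 x)"
      by (simp add: E_def)
    show ?thesis
    proof (rule ex1I[of _ f])
      show "f \<in> cont_hom G T P \<and> (\<forall>x\<in>H. f x = \<psi>1 x) \<and> (\<forall>x\<in>K. f x = \<psi>2 x)" by (rule f)
      fix f' assume "f' \<in> cont_hom G T P \<and> (\<forall>x\<in>H. f' x = \<psi>1 x) \<and> (\<forall>x\<in>K. f' x = \<psi>2 x)"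
      then show "f' = f" using unique[of f' f] f by simp
    qed
  qed
  then show ?thesis
    unfolding is_free_pro_C_product_def using H K_closed K_def by blast
qed

theorem proposition3p1:
  fixes C :: "nat monoid set" and G :: "'a monoid" and T :: "'a topology" and H :: "'a set"
  assumes "extension_closed_pseudovariety C"
    and "pro_C_group C G T"
    and "top_finitely_generated G T"
    and "closed_subgroup G T H"
    and "top_finitely_generated (G\<lparr>carrier := H\<rparr>) (subtopology T H)"
  shows "free_pro_C_factor C G T H \<longleftrightarrow>
    (\<forall>P\<in>C. \<forall>\<gamma>\<^sub>1\<in>cont_hom_on G T H P. \<forall>\<gamma>\<^sub>2\<in>cont_hom_on G T H P.
       num_extensions G T H \<gamma>\<^sub>1 P = num_extensions G T H \<gamma>\<^sub>2 P)"
proof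
  assume "free_pro_C_factor C G T H"
  then obtain K where "is_free_pro_C_product C G T H K"
    unfolding free_pro_C_factor_def by blast
  then show "\<forall>P\<in>C. \<forall>\<gamma>\<^sub>1\<in>cont_hom_on G T H P. \<forall>\<gamma>\<^sub>2\<in>cont_hom_on G T H P.
      num_extensions G T H \<gamma>\<^sub>1 P = num_extensions G T H \<gamma>\<^sub>2 P"
    using num_extensions_free_product by metis
next
  assume indep: "\<forall>P\<in>C. \<forall>\<gamma>\<^sub>1\<in>cont_hom_on G T H P. \<forall>\<gamma>\<^sub>2\<in>cont_hom_on G T H P.
      num_extensions G T H \<gamma>\<^sub>1 P = num_extensions G T H \<gamma>\<^sub>2 P"
  have C: "pseudovariety C"
    using assms(1) by (simp add: extension_closed_pseudovariety_def)
  have H: "subgroup H G" using assms(4) by (simp add: closed_subgroup_def)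
  obtain I :: "'a set set" and r A \<phi> p where coords: "finite_coordinates G T I r A \<phi> p"
    and AC: "A ` I \<subseteq> C"
    using pro_C_group_finite_coordinates[OF C assms(2)] by (elim exE conjE) (rule that)
  interpret finite_coordinates G T I r A \<phi> p by (rule coords)
  have const: "constant_num_extensions C G T H"
    unfolding constant_num_extensions_def by (rule indep)
  obtain s where s: "s \<in> hom G G" "continuous_map T T s" "\<And>x. x \<in> H \<Longrightarrow> s x = \<one>\<^bsub>G\<^esub>"
    "\<And>D. closed_subgroup G T D \<Longrightarrow> H \<subseteq> D \<Longrightarrow> s ` carrier G \<subseteq> D \<Longrightarrow> D = carrier G"
    by (rule exists_endomorphism_generating_with_subgroup[OF C AC assms(3) H const]) (rule that)
  have "is_free_pro_C_product C G T H (s ` carrier G)"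
    by (rule free_product_with_image)
      (fact C group_G topspace_T compact_T Hausdorff_T assms(3,4) s
        const)+
  then show "free_pro_C_factor C G T H"
    unfolding free_pro_C_factor_def is_free_pro_C_product_def by blast
qed

end
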